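(* For all integers $r,s\ge 0$ and $k\ge 1$, one has the identity of operators on $T^{r+k+s}$ $$(I_r\otimes \mathcal P_{q\text{-sym}}^{k}\otimes I_s)\,\mathcal P_{q\text{-sym}}^{\,r+k+s}=\mathcal P_{q\text{-sym}}^{\,r+k+s}.$$
   Context: Setting. $V$ is a complex vector space with basis $X_1,\dots,X_N$; $T=T(V)=\bigoplus_{r\ge 0}T^r$, $T^r=V^{\otimes r}$; the sign $\otimes$ is often omitted. Fix $q\in\mathbb C^*$ and, for $N\ge i>j\ge 1$, nonzero complex numbers of the form $b_{ij}=q^{\alpha_{ij}}$ and elements $p_{ij}\in\mathrm{Span}\{X_aX_b\mid 1\le a,b\le i-1\}\subset T^2$. $I_R\subset T$ is the two-sided ideal generated by all $X_iX_j-b_{ij}X_jX_i-p_{ij}$ ($i>j$), and $\mathcal A=T/I_R$. Order. For a monomial $X=X_{i_1}\cdots X_{i_r}\in T^r$ put $\ell(X)=(n_1,\dots,n_N)$, $n_i=\#\{s\mid i_s=i\}$. On $\{0,\dots,r\}^N$ use the lexicographic order $\le_l$ in which the last coordinate is most significant (so $(0,\dots,0,r)$ is the biggest). For monomials $u,u'\in T^r$, $u'\le_l u$ means $\ell(u')\le_l\ell(u)$; the order of a nonzero element of $T^r$ is the largest $\ell$ of the monomials occurring in it, and elements are compared via their orders. Standing assumption (EA): every nonzero homogeneous $u\in I_R$ lies in the span of the elements $a(X_iX_j-b_{ij}X_jX_i-p_{ij})b$ with $i>j$, $a,b$ monomials in $T$, and $aX_iX_jb\le_l u$. Operators. $S:V\otimes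 V\to V\otimes V$ is the linear map with $S(X_iX_j)=b_{ij}X_jX_i+p_{ij}$ and $S(X_jX_i)=b_{ij}^{-1}(X_iX_j-p_{ij})$ for $i>j$, and $S(X_iX_i)=X_iX_i$. On $T^n$, $\sigma_i$ ($1\le i\le n-1$) is $S$ applied in tensor positions $i,i+1$. For each $\sigma\in S_n$ (symmetric group) choose an expression $\sigma=s_{i_1}\cdots s_{i_m}$ as a product of elementary transpositions $s_j=(j\ j{+}1)$ and put $\widehat\sigma=\sigma_{i_1}\cdots\sigma_{i_m}$; put $P=\frac1{n!}\sum_{\sigma\in S_n}\widehat\sigma$ on $T^n$. Then $\mathcal P_{q\text{-sym}}=\lim_{M\to\infty}P^M$ (for each $u\in T^n$ the sequence $P^M(u)$ is eventually constant, and the limit does not depend on the choices of expressions). $\mathcal P^n_{q\text{-sym}}$ is its restriction to $T^n$. $I_r\otimes\mathcal P_{q\text{-sym}}^k\otimes I_s$ is the operator on $T^{r+k+s}=T^r\otimes T^k\otimes T^s$ acting as $\mathcal P_{q\text{-sym}}^k$ on the middle factor and as the identity on the other two. *)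

theory Defs
  imports "HOL-Analysis.Analysis" "HOL-Library.Poly_Mapping" "HOL-Combinatorics.Permutations"
begin

section \<open>The tensor algebra on a finite ordered basis\<close>

text \<open>
  The basis \<open>X\<^sub>1, \<dots>, X\<^sub>N\<close> of \<open>V\<close> is indexed by a finite linearly ordered type \<open>'n\<close>
  (with \<open>N\<close> elements). A monomial \<open>X\<^sub>i \<otimes> \<dots> \<otimes> X\<^sub>j\<close> is a word, i.e. a list over \<open>'n\<close>,
  and \<open>T(V)\<close> is the monoid algebra over the complex numbers of the free monoid of words; its
  multiplication is the one of type \<^typ>\<open>'a \<Rightarrow>\<^sub>0 'b\<close>, i.e. concatenation of words.
\<close>

instantiation list :: (type) monoid_add
begin

definition zero_list :: "'a list" where "zero_list = []"

definition plus_list :: "'a list \<Rightarrow> 'a list \<Rightarrow> 'a list" where "plus_list = (@)"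

instance by standard (simp_all add: zero_list_def plus_list_def)

end

type_synonym 'n tensor = "'n list \<Rightarrow>\<^sub>0 complex"

definition mon :: "'n list \<Rightarrow> 'n tensor" where
  "mon w = Poly_Mapping.single w 1"

definition csmult :: "complex \<Rightarrow> 'n tensor \<Rightarrow> 'n tensor" where
  "csmult c u = Poly_Mapping.map ((*) c) u"

lemma lookup_csmult: "Poly_Mapping.lookup (csmult c u) w = c * Poly_Mapping.lookup u w"
  unfolding csmult_def by transfer (simp add: when_def)

global_interpretation tensor: vector_space csmult
  defines tensor_span = "tensor.span"
  by standard
    (auto intro!: poly_mapping_eqI simp: lookup_csmult lookup_add algebra_simps)

lemma mon_mult: "mon v * mon w = mon (v @ w)"
  by (simp add: mon_def mult_single plus_list_def)

lemma mon_Nil: "mon [] = 1"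
  using single_one by (metis mon_def zero_list_def)

definition tensor_power :: "nat \<Rightarrow> 'n tensor set" where
  "tensor_power n = {u. \<forall>w \<in> Poly_Mapping.keys u. length w = n}"

definition lin_ext :: "('n list \<Rightarrow> 'n tensor) \<Rightarrow> 'n tensor \<Rightarrow> 'n tensor" where
  "lin_ext f u = (\<Sum>w \<in> Poly_Mapping.keys u. csmult (Poly_Mapping.lookup u w) (f w))"

text \<open>
  \<open>amplify r k A\<close> is \<open>I\<^sub>r \<otimes> A \<otimes> I\<^sub>s\<close> for a linear operator \<open>A\<close> on the \<open>k\<close>-th tensor power. The
  number \<open>s\<close> is not a parameter: it is determined by the degree \<open>r + k + s\<close> of the argument.
\<close>

definition amplify :: "nat \<Rightarrow> nat \<Rightarrow> ('n tensor \<Rightarrow> 'n tensor) \<Rightarrow> 'n tensor \<Rightarrow> 'n tensor" where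
  "amplify r k A =
     lin_ext (\<lambda>w. mon (take r w) * A (mon (take k (drop r w))) * mon (drop (r + k) w))"


section \<open>The relations, the ideal and the order\<close>

definition relator ::
  "('n \<Rightarrow> 'n \<Rightarrow> complex) \<Rightarrow> ('n \<Rightarrow> 'n \<Rightarrow> 'n tensor) \<Rightarrow> 'n \<Rightarrow> 'n \<Rightarrow> 'n tensor" where
  "relator b p i j = mon [i, j] - csmult (b i j) (mon [j, i]) - p i j"

definition two_sided_ideal :: "'a::ring_1 set \<Rightarrow> bool" where
  "two_sided_ideal I \<longleftrightarrow>
     0 \<in> I \<and> (\<forall>x\<in>I. \<forall>y\<in>I. x + y \<in> I) \<and> (\<forall>x\<in>I. \<forall>a. a * x \<in> I \<and> x * a \<in> I)"

definition ideal_generated :: "'a::ring_1 set \<Rightarrow> 'a set" where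
  "ideal_generated G = \<Inter> {I. two_sided_ideal I \<and> G \<subseteq> I}"

definition relation_ideal ::
  "('n::linorder \<Rightarrow> 'n \<Rightarrow> complex) \<Rightarrow> ('n \<Rightarrow> 'n \<Rightarrow> 'n tensor) \<Rightarrow> 'n tensor set" where
  "relation_ideal b p = ideal_generated {relator b p i j | i j. j < i}"

definition multidegree :: "'n list \<Rightarrow> 'n \<Rightarrow> nat" where
  "multidegree w = (\<lambda>i. count_list w i)"

text \<open>The largest index is the most significant one.\<close>

definition lex_le :: "('n::linorder \<Rightarrow> nat) \<Rightarrow> ('n \<Rightarrow> nat) \<Rightarrow> bool" where
  "lex_le m m' \<longleftrightarrow> m = m' \<or> (\<exists>i. m i < m' i \<and> (\<forall>j>i. m j = m' j))"

definition tensor_order :: "'n::linorder tensor \<Rightarrow> 'n \<Rightarrow> nat" where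
  "tensor_order u = (THE m. m \<in> multidegree ` Poly_Mapping.keys u \<and>
     (\<forall>w \<in> Poly_Mapping.keys u. lex_le (multidegree w) m))"

text \<open>
  The standing assumption (EA). The order only compares elements of the same tensor power, hence
  the condition on the length of \<open>x @ [i, j] @ y\<close>.
\<close>

definition EA :: "('n::linorder \<Rightarrow> 'n \<Rightarrow> complex) \<Rightarrow> ('n \<Rightarrow> 'n \<Rightarrow> 'n tensor) \<Rightarrow> bool" where
  "EA b p \<longleftrightarrow> (\<forall>n. \<forall>u \<in> relation_ideal b p \<inter> tensor_power n. u \<noteq> 0 \<longrightarrow>
     u \<in> tensor_span {mon x * relator b p i j * mon y | x i j y.
            j < i \<and> length (x @ [i, j] @ y) = n \<and>
            lex_le (multidegree (x @ [i, j] @ y)) (tensor_order u)})"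


section \<open>The operators\<close>

definition S_op ::
  "('n::linorder \<Rightarrow> 'n \<Rightarrow> complex) \<Rightarrow> ('n \<Rightarrow> 'n \<Rightarrow> 'n tensor) \<Rightarrow> 'n tensor \<Rightarrow> 'n tensor" where
  "S_op b p = lin_ext (\<lambda>w. let i = w ! 0; j = w ! 1 in
     if j < i then csmult (b i j) (mon [j, i]) + p i j
     else if i < j then csmult (inverse (b j i)) (mon [j, i] - p j i)
     else mon [i, i])"

definition sigma_op ::
  "('n::linorder \<Rightarrow> 'n \<Rightarrow> complex) \<Rightarrow> ('n \<Rightarrow> 'n \<Rightarrow> 'n tensor) \<Rightarrow> nat \<Rightarrow> 'n tensor \<Rightarrow> 'n tensor"
  where "sigma_op b p i = amplify (i - 1) 2 (S_op b p)"

text \<open>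
  A choice, for every permutation of \<open>{1..n}\<close>, of an expression (not necessarily a reduced one) as a
  product of the elementary transpositions \<open>s\<^sub>j = (j j+1)\<close>, given by the list of the indices \<open>j\<close>.
\<close>

definition expression_choice :: "nat \<Rightarrow> ((nat \<Rightarrow> nat) \<Rightarrow> nat list) \<Rightarrow> bool" where
  "expression_choice n e \<longleftrightarrow> (\<forall>\<pi>. \<pi> permutes {1..n} \<longrightarrow>
     set (e \<pi>) \<subseteq> {1..<n} \<and> \<pi> = foldr (\<lambda>j f. Transposition.transpose j (j + 1) \<circ> f) (e \<pi>) id)"

definition word_op ::
  "('n::linorder \<Rightarrow> 'n \<Rightarrow> complex) \<Rightarrow> ('n \<Rightarrow> 'n \<Rightarrow> 'n tensor) \<Rightarrow> nat list \<Rightarrow> 'n tensor \<Rightarrow> 'n tensor"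
  where "word_op b p is = foldr (\<lambda>i f. sigma_op b p i \<circ> f) is id"

definition P_op ::
  "('n::linorder \<Rightarrow> 'n \<Rightarrow> complex) \<Rightarrow> ('n \<Rightarrow> 'n \<Rightarrow> 'n tensor) \<Rightarrow> ((nat \<Rightarrow> nat) \<Rightarrow> nat list) \<Rightarrow> nat
     \<Rightarrow> 'n tensor \<Rightarrow> 'n tensor" where
  "P_op b p e n u = csmult (1 / fact n) (\<Sum>\<pi> | \<pi> permutes {1..n}. word_op b p (e \<pi>) u)"

text \<open>
  The limit of \<open>P\<^sup>M(u)\<close> for \<open>M \<rightarrow> \<infinity>\<close> is the value at which this sequence becomes stationary.
\<close>

definition qsym ::
  "('n::linorder \<Rightarrow> 'n \<Rightarrow> complex) \<Rightarrow> ('n \<Rightarrow> 'n \<Rightarrow> 'n tensor) \<Rightarrow> ((nat \<Rightarrow> nat) \<Rightarrow> nat list) \<Rightarrow> nat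
     \<Rightarrow> 'n tensor \<Rightarrow> 'n tensor" where
  "qsym b p e n u = (THE v. \<forall>\<^sub>F M in sequentially. (P_op b p e n ^^ M) u = v)"

end

theory Submission
  imports Defs
begin

text \<open>
  Filter the tensors by a weight that every \<open>p i j\<close> lowers. Up to lower terms, the operators
  \<open>\<sigma>\<^sub>i\<close> permute suitably rescaled monomials, so \<open>P\<close> is, up to lower terms, a projection onto the
  tensors invariant under the braiding with \<open>p = 0\<close>. On each pair of positions these invariants are
  combinations of \<open>X\<^sub>i X\<^sub>i\<close> and \<open>X\<^sub>i X\<^sub>j + b i j X\<^sub>j X\<^sub>i\<close>, in which the contributions of \<open>p i j\<close> to
  \<open>S\<close> cancel; so \<open>P\<close> fixes them for every \<open>p\<close>. Hence iterating \<open>P\<close> on any tensor becomes stationary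
  at such an invariant, by induction on the weight. A slice of an invariant tensor in \<open>k\<close> consecutive
  positions is again invariant, hence fixed by the projection of degree \<open>k\<close>.
\<close>

section \<open>Linear operators on the tensor algebra\<close>

abbreviation linear_op :: "('n tensor \<Rightarrow> 'n tensor) \<Rightarrow> bool" where
  "linear_op \<equiv> module_hom csmult csmult"

text \<open>Coordinate subspaces describe both the grading by length and the filtration by weight,
  so one set of closure rules serves both.\<close>

definition supported :: "'n list set \<Rightarrow> 'n tensor set" where
  "supported K = {u. Poly_Mapping.keys u \<subseteq> K}"

definition words :: "nat \<Rightarrow> 'n list set" where
  "words n = {w. length w = n}"

lemma tensor_power_eq: "tensor_power n = supported (words n)"
  by (auto simp: tensor_power_def supported_def words_def)

lemma finite_words [simp]: "finite (words n :: 'n::finite list set)"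
  using finite_lists_length_eq[of "UNIV :: 'n set" n] by (simp add: words_def)

lemma sum_words_add:
  "(\<Sum>w\<in>words (m + n). h w) = (\<Sum>x\<in>words m. \<Sum>y\<in>words n. h (x @ y))"
  unfolding sum.cartesian_product
  by (rule sum.reindex_bij_witness[where i = "\<lambda>(x, y). x @ y" and j = "\<lambda>w. (take m w, drop m w)"])
    (auto simp: words_def)

lemma lookup_mon: "Poly_Mapping.lookup (mon w) v = of_bool (w = v)"
  by (simp add: mon_def lookup_single when_def)

lemma keys_mon: "Poly_Mapping.keys (mon w) = {w}"
  by (simp add: mon_def)

lemma supported_mon [simp]: "mon w \<in> supported K \<longleftrightarrow> w \<in> K"
  by (simp add: supported_def keys_mon)

lemma supported_mono: "u \<in> supported K \<Longrightarrow> K \<subseteq> K' \<Longrightarrow> u \<in> supported K'"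
  by (auto simp: supported_def)

lemma supported_iff: "u \<in> supported K \<longleftrightarrow> (\<forall>w. w \<notin> K \<longrightarrow> Poly_Mapping.lookup u w = 0)"
  by (auto simp: supported_def in_keys_iff)

lemma subspace_supported: "tensor.subspace (supported K)"
  by (auto simp: tensor.subspace_def supported_iff lookup_add lookup_csmult)

lemmas supported_zero = tensor.subspace_0[OF subspace_supported]
  and supported_add = tensor.subspace_add[OF subspace_supported]
  and supported_scale = tensor.subspace_scale[OF subspace_supported]
  and supported_sum = tensor.subspace_sum[OF subspace_supported]

lemma sum_mon:
  assumes "finite K" "u \<in> supported K"
  shows "(\<Sum>w\<in>K. csmult (Poly_Mapping.lookup u w) (mon w)) = u"
proof (rule poly_mapping_eqI)
  fix v
  have "(\<Sum>w\<in>K. Poly_Mapping.lookup u w * of_bool (w = v)) = Poly_Mapping.lookup u v"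
    using assms by (auto simp: of_bool_def supported_iff if_distrib cong: if_cong)
  then show "Poly_Mapping.lookup (\<Sum>w\<in>K. csmult (Poly_Mapping.lookup u w) (mon w)) v
      = Poly_Mapping.lookup u v"
    by (simp add: lookup_sum lookup_csmult lookup_mon)
qed

lemma lin_ext_eq_sum:
  assumes "finite K" "u \<in> supported K"
  shows "lin_ext f u = (\<Sum>w\<in>K. csmult (Poly_Mapping.lookup u w) (f w))"
  unfolding lin_ext_def using assms
  by (intro sum.mono_neutral_left) (auto simp: supported_def in_keys_iff)

lemma lin_ext_mon [simp]: "lin_ext f (mon w) = f w"
  by (simp add: lin_ext_def keys_mon lookup_mon)

lemma linear_lin_ext: "linear_op (lin_ext f)"
proof -
  have add: "lin_ext f (u + v) = lin_ext f u + lin_ext f v" for u v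
  proof -
    let ?K = "Poly_Mapping.keys u \<union> Poly_Mapping.keys v"
    have "u \<in> supported ?K" "v \<in> supported ?K"
      by (auto simp: supported_def)
    then show ?thesis
      by (simp add: lin_ext_eq_sum[of ?K] supported_add lookup_add tensor.scale_left_distrib
          sum.distrib)
  qed
  have scale: "lin_ext f (csmult c u) = csmult c (lin_ext f u)" for c u
  proof -
    have "u \<in> supported (Poly_Mapping.keys u)"
      by (auto simp: supported_def)
    then show ?thesis
      by (simp add: lin_ext_eq_sum[of "Poly_Mapping.keys u"] supported_scale lookup_csmult
          tensor.scale_sum_right)
  qed
  show ?thesis
    by (simp add: module_hom_iff tensor.module_axioms add scale)
qed

lemma linear_op_supported:
  assumes "linear_op A" "u \<in> supported K" "\<And>w. w \<in> K \<Longrightarrow> A (mon w) \<in> supported L"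
  shows "A u \<in> supported L"
proof -
  have "u = (\<Sum>w\<in>Poly_Mapping.keys u. csmult (Poly_Mapping.lookup u w) (mon w))"
    by (rule sum_mon[symmetric]) (auto simp: supported_def)
  then have "A u = (\<Sum>w\<in>Poly_Mapping.keys u. csmult (Poly_Mapping.lookup u w) (A (mon w)))"
    by (metis (no_types, lifting) module_hom.scale[OF assms(1)] module_hom.sum[OF assms(1)] sum.cong)
  moreover have "Poly_Mapping.keys u \<subseteq> K"
    using assms(2) by (simp add: supported_def)
  ultimately show ?thesis
    using assms(3) by (auto intro!: supported_sum supported_scale)
qed

lemma linear_op_funpow: "linear_op A \<Longrightarrow> linear_op (A ^^ M)"
  by (induction M) (simp_all add: module_hom_iff)

lemma csmult_mult_left: "csmult c u * v = csmult c (u * v)"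
  by (simp add: csmult_def mult_map_scale_conv_mult mult.assoc)

text \<open>Scalars sit on the empty word, which is \<open>0\<close> in the list monoid and commutes
  with every word. As a right factor, a scalar can be moved by associativity.\<close>

lemma csmult_conv_mult_right: "csmult c u = u * Poly_Mapping.single 0 c"
proof -
  have "u * Poly_Mapping.single 0 c = (\<Sum>w\<in>Poly_Mapping.keys u.
      csmult (Poly_Mapping.lookup u w) (mon w) * Poly_Mapping.single 0 c)"
    using sum_mon[of "Poly_Mapping.keys u" u] by (simp add: supported_def flip: sum_distrib_right)
  also have "\<dots> = (\<Sum>w\<in>Poly_Mapping.keys u. csmult c (csmult (Poly_Mapping.lookup u w) (mon w)))"
    by (simp add: csmult_def mult_single mon_def mult.commute)
  also have "\<dots> = csmult c u"
    using sum_mon[of "Poly_Mapping.keys u" u] by (simp add: supported_def del: tensor.scale_scale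
        flip: tensor.scale_sum_right)
  finally show ?thesis by simp
qed

lemma csmult_mult_right: "u * csmult c v = csmult c (u * v)"
  by (simp add: csmult_conv_mult_right mult.assoc)

lemma sandwich_supported:
  assumes "u \<in> supported K"
  shows "mon x * u * mon y \<in> supported ((\<lambda>w. x @ w @ y) ` K)"
proof (rule linear_op_supported[OF _ assms])
  show "linear_op (\<lambda>u. mon x * u * mon y)"
    by (simp add: module_hom_iff tensor.module_axioms algebra_simps csmult_mult_left csmult_mult_right)
qed (auto simp: mon_mult)

section \<open>Operators acting on a block of consecutive positions\<close>

lemma amplify_mon:
  "length x = r \<Longrightarrow> length y = k \<Longrightarrow> amplify r k A (mon (x @ y @ z)) = mon x * A (mon y) * mon z"
  by (simp add: amplify_def)

lemma linear_amplify: "linear_op (amplify r k A)"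
  unfolding amplify_def by (rule linear_lin_ext)

text \<open>\<open>amplify\<close> evaluates its operator on monomials only. This allows
  \<open>qsym\<close> to be traded for a power of \<open>P_op\<close>, whose linearity is
  known.\<close>

lemma amplify_cong:
  assumes "u \<in> tensor_power (r + k + s)" "\<And>y. length y = k \<Longrightarrow> A (mon y) = B (mon y)"
  shows "amplify r k A u = amplify r k B u"
  unfolding amplify_def lin_ext_def using assms by (intro sum.cong) (auto simp: tensor_power_def)

text \<open>The contraction of \<open>u\<close> with the dual monomials of \<open>x\<close> on the
  left and \<open>z\<close> on the right.\<close>

definition slice :: "nat \<Rightarrow> 'n::finite list \<Rightarrow> 'n list \<Rightarrow> 'n tensor \<Rightarrow> 'n tensor" where
  "slice k x z u = (\<Sum>y\<in>words k. csmult (Poly_Mapping.lookup u (x @ y @ z)) (mon y))"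

lemma lookup_slice:
  "Poly_Mapping.lookup (slice k x z u) y
    = (if length y = k then Poly_Mapping.lookup u (x @ y @ z) else 0)"
  by (simp add: slice_def lookup_sum lookup_csmult lookup_mon of_bool_def if_distrib words_def[of k]
      finite_words[unfolded words_def] cong: if_cong)

lemma amplify_eq_sum_slices:
  assumes "linear_op A" "u \<in> tensor_power (r + k + s)"
  shows "amplify r k A u = (\<Sum>x\<in>words r. \<Sum>z\<in>words s. mon x * A (slice k x z u) * mon z)"
proof -
  have "amplify r k A u = (\<Sum>x\<in>words r. \<Sum>y\<in>words k. \<Sum>z\<in>words s.
      csmult (Poly_Mapping.lookup u (x @ y @ z)) (mon x * A (mon y) * mon z))"
    unfolding amplify_def lin_ext_eq_sum[OF finite_words assms(2)[unfolded tensor_power_eq]]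
      add.assoc sum_words_add
    by (intro sum.cong refl) (simp add: words_def)
  also have "\<dots> = (\<Sum>x\<in>words r. \<Sum>z\<in>words s. \<Sum>y\<in>words k.
      csmult (Poly_Mapping.lookup u (x @ y @ z)) (mon x * A (mon y) * mon z))"
    by (intro sum.cong refl sum.swap)
  also have "\<dots> = (\<Sum>x\<in>words r. \<Sum>z\<in>words s. mon x * A (slice k x z u) * mon z)"
    by (simp add: slice_def module_hom.sum[OF assms(1)] module_hom.scale[OF assms(1)]
        sum_distrib_left sum_distrib_right csmult_mult_left csmult_mult_right)
  finally show ?thesis .
qed

lemma amplify_id:
  assumes "u \<in> tensor_power (r + k + s)"
  shows "amplify r k (\<lambda>v. v) u = u"
proof -
  have "mon (take r w) * mon (take k (drop r w)) * mon (drop (r + k) w) = mon w" for w :: "'a list"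
    by (metis append_take_drop_id drop_drop mon_mult add.commute append.assoc)
  then have "amplify r k (\<lambda>v. v) u = lin_ext mon u"
    by (simp add: amplify_def)
  also have "\<dots> = u"
    using sum_mon[of "Poly_Mapping.keys u" u] by (simp add: lin_ext_def supported_def)
  finally show ?thesis .
qed


section \<open>Weights and permuted words\<close>

text \<open>
  A numerical substitute for the lexicographic order: two letters below \<open>i\<close> together weigh at most
  as much as \<open>i\<close> alone, so replacing \<open>X\<^sub>i X\<^sub>j\<close> by a term of \<open>p i j\<close> lowers the weight.
\<close>

definition weight :: "'n::{finite, linorder} list \<Rightarrow> nat" where
  "weight w = (\<Sum>i\<leftarrow>w. 2 ^ card {x. x < i})"

lemma weight_Nil [simp]: "weight [] = 0"
  and weight_Cons [simp]: "weight (i # w) = 2 ^ card {x. x < i} + weight w"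
  and weight_append [simp]: "weight (v @ w) = weight v + weight w"
  by (simp_all add: weight_def)

lemma weight_pair_less:
  fixes i :: "'n::{finite, linorder}"
  assumes "x < i" "y < i"
  shows "weight [x, y] < weight [i, j]"
proof -
  \<comment> \<open>The letters below \<open>z\<close> form a proper subset of those below
    \<open>i\<close>, so the exponent drops by at least 1.\<close>
  have half: "2 * 2 ^ card {a. a < z} \<le> (2::nat) ^ card {a. a < i}" if "z < i" for z
  proof -
    have "card {a. a < z} < card {a. a < i}"
      using that by (intro psubset_card_mono) auto
    then show ?thesis
      by (metis Suc_leI one_le_numeral power_Suc power_increasing)
  qed
  \<comment> \<open>The positive weight of \<open>j\<close> makes the comparison strict.\<close>
  have "0 < (2::nat) ^ card {a. a < j}"
    by simp
  with half[OF assms(1)] half[OF assms(2)] show ?thesis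
    unfolding weight_Cons weight_Nil by linarith
qed

definition lower_tensors :: "nat \<Rightarrow> nat \<Rightarrow> 'n::{finite, linorder} tensor set" where
  "lower_tensors n d = supported {w. length w = n \<and> weight w < d}"

lemma lower_tensors_mono: "d \<le> d' \<Longrightarrow> u \<in> lower_tensors n d \<Longrightarrow> u \<in> lower_tensors n d'"
  unfolding lower_tensors_def by (erule supported_mono) auto

text \<open>Permutations act on positions counted from 1, whereas \<open>(!)\<close> counts from 0.\<close>

definition permute_word :: "(nat \<Rightarrow> nat) \<Rightarrow> 'n list \<Rightarrow> 'n list" where
  "permute_word \<rho> w = map (\<lambda>k. w ! (\<rho> (Suc k) - 1)) [0..<length w]"

lemma length_permute_word [simp]: "length (permute_word \<rho> w) = length w"
  by (simp add: permute_word_def)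

lemma permute_word_id: "permute_word id w = w"
  by (simp add: permute_word_def map_nth)

text \<open>Letters are read through the permutation, which gives a right action. This is why
  inverses appear when operators are composed from the left.\<close>

lemma permute_word_comp:
  assumes "\<tau> permutes {1..length w}"
  shows "permute_word \<tau> (permute_word \<rho> w) = permute_word (\<rho> \<circ> \<tau>) w"
proof (rule nth_equalityI)
  fix k assume "k < length (permute_word \<tau> (permute_word \<rho> w))"
  \<comment> \<open>Since \<open>\<tau>\<close> keeps positions in range, subtracting 1 does not
    truncate.\<close>
  then have "\<tau> (Suc k) \<in> {1..length w}" and "k < length w"
    using permutes_in_image[OF assms, of "Suc k"] by auto
  then show "permute_word \<tau> (permute_word \<rho> w) ! k = permute_word (\<rho> \<circ> \<tau>) w ! k"
    by (auto simp: permute_word_def)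
qed simp

lemma permute_word_transpose:
  assumes "1 \<le> i" "length x = i - 1"
  shows "permute_word (Transposition.transpose i (i + 1)) (x @ [a, c] @ y) = x @ [c, a] @ y"
proof (rule nth_equalityI)
  have i: "i = Suc (length x)"
    using assms by simp
  let ?w = "x @ [a, c] @ y"
  fix k assume "k < length (permute_word (Transposition.transpose i (i + 1)) ?w)"
  then have nth: "permute_word (Transposition.transpose i (i + 1)) ?w ! k
      = ?w ! (Transposition.transpose i (i + 1) (Suc k) - 1)"
    by (simp add: permute_word_def del: upt_Suc)
  consider "k < length x" | "k = length x" | "k = Suc (length x)" | d where "k = length x + Suc (Suc d)"
    by (metis add_Suc_right less_add_eq_less less_iff_Suc_add linorder_neqE_nat Suc_lessI)
  then show "permute_word (Transposition.transpose i (i + 1)) ?w ! k = (x @ [c, a] @ y) ! k"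
    unfolding nth by cases (simp_all add: i transpose_def nth_append)
qed simp

lemma split_at_position:
  assumes "1 \<le> i" "i < length w"
  obtains x a c y where "w = x @ [a, c] @ y" "length x = i - 1"
proof
  show "w = take (i - 1) w @ [w ! (i - 1), w ! i] @ drop (i + 1) w"
    using assms id_take_nth_drop[of "i - 1" w] by (simp add: Cons_nth_drop_Suc)
  show "length (take (i - 1) w) = i - 1"
    using assms by simp
qed

lemma permutes_adjacent:
  "1 \<le> i \<Longrightarrow> i < n \<Longrightarrow> Transposition.transpose i (i + 1 :: nat) permutes {1..n}"
  by (rule permutes_swap_id) simp_all


section \<open>Invariant tensors\<close>

locale quantum_relations =
  fixes b :: "'n::{finite, linorder} \<Rightarrow> 'n \<Rightarrow> complex" and p :: "'n \<Rightarrow> 'n \<Rightarrow> 'n tensor"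
  assumes b_nonzero: "j < i \<Longrightarrow> b i j \<noteq> 0"
    and p_supported: "j < i \<Longrightarrow> p i j \<in> supported {[x, y] | x y. x < i \<and> y < i}"
begin

text \<open>
  These are the tensors fixed by all \<open>\<sigma>\<^sub>i\<close> for \<open>p = 0\<close>; the point is that \<open>p\<close> does not move them.
\<close>

definition invariants :: "nat \<Rightarrow> 'n tensor set" where
  "invariants n = {u \<in> tensor_power n. \<forall>x y i j. j < i \<longrightarrow>
     Poly_Mapping.lookup u (x @ [j, i] @ y) = b i j * Poly_Mapping.lookup u (x @ [i, j] @ y)}"

lemma subspace_invariants: "tensor.subspace (invariants n)"
  by (auto simp: tensor.subspace_def invariants_def tensor_power_eq supported_zero supported_add
      supported_scale lookup_add lookup_csmult algebra_simps)

text \<open>Invariance is a local condition on two adjacent letters in an arbitrary context, and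
  \<open>x\<close> and \<open>z\<close> merely extend that context.\<close>

lemma slice_invariants:
  assumes "u \<in> invariants n"
  shows "slice k x z u \<in> invariants k"
proof -
  have "Poly_Mapping.lookup u (x @ (v @ [j, i] @ w) @ z)
      = b i j * Poly_Mapping.lookup u (x @ (v @ [i, j] @ w) @ z)" if "j < i" for v w i j
  proof -
    have "Poly_Mapping.lookup u ((x @ v) @ [j, i] @ (w @ z))
        = b i j * Poly_Mapping.lookup u ((x @ v) @ [i, j] @ (w @ z))"
      using assms that unfolding invariants_def by blast
    then show ?thesis by simp
  qed
  then show ?thesis
    by (auto simp: invariants_def tensor_power_eq supported_iff lookup_slice words_def)
qed

text \<open>Expanded into slices, \<open>A\<close> meets only invariants of degree \<open>k\<close>,
  so it can be replaced by the identity.\<close>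

lemma amplify_invariants:
  assumes "linear_op A" "\<And>v. v \<in> invariants k \<Longrightarrow> A v = v" "u \<in> invariants (r + k + s)"
  shows "amplify r k A u = u"
proof -
  have u: "u \<in> tensor_power (r + k + s)"
    using assms(3) by (simp add: invariants_def)
  have "linear_op (\<lambda>v. v :: 'n tensor)"
    by (simp add: module_hom_iff tensor.module_axioms)
  then have "amplify r k A u = amplify r k (\<lambda>v. v) u"
    using assms by (simp add: amplify_eq_sum_slices[OF _ u] slice_invariants)
  then show ?thesis
    by (simp add: amplify_id[OF u])
qed

section \<open>Operators fixing the invariants\<close>

lemma S_op_gt: "j < i \<Longrightarrow> S_op b p (mon [i, j]) = csmult (b i j) (mon [j, i]) + p i j"
  and S_op_lt: "j < i \<Longrightarrow> S_op b p (mon [j, i]) = csmult (inverse (b i j)) (mon [i, j] - p i j)"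
  and S_op_eq: "S_op b p (mon [i, i]) = mon [i, i]"
  by (auto simp: S_op_def)

lemma linear_S_op: "linear_op (S_op b p)"
  unfolding S_op_def by (rule linear_lin_ext)

text \<open>The words \<open>[i, j]\<close> and \<open>[j, i]\<close> contribute opposite amounts to
  \<open>S_op b p u - u\<close>. For j < i and coefficient c of \<open>[i, j]\<close>, the
  coefficient of \<open>[j, i]\<close> is \<open>b i j * c\<close>, so \<open>p i j\<close> enters
  once with c and once with -c.\<close>

lemma S_op_invariants:
  assumes "u \<in> invariants 2"
  shows "S_op b p u = u"
proof -
  define h where "h i j =
    csmult (Poly_Mapping.lookup u [i, j]) (S_op b p (mon [i, j]) - mon [i, j])" for i j
  have u: "u \<in> supported (words 2)"
    using assms by (simp add: invariants_def tensor_power_eq)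
  have antisym: "h i j = - h j i" if "j < i" for i j
  proof (rule poly_mapping_eqI)
    fix w
    have "Poly_Mapping.lookup u ([] @ [j, i] @ []) = b i j * Poly_Mapping.lookup u ([] @ [i, j] @ [])"
      using assms that unfolding invariants_def by blast
    then show "Poly_Mapping.lookup (h i j) w = Poly_Mapping.lookup (- h j i) w"
      using b_nonzero[OF that] that
      by (simp add: h_def S_op_gt S_op_lt lookup_csmult lookup_add lookup_minus field_simps)
  qed
  have antisym': "h i j = - h j i" for i j
    using antisym[of i j] antisym[of j i]
    by (cases i j rule: linorder_cases) (simp_all add: h_def S_op_eq)
  have words2: "words 2 = (\<lambda>(i, j). [i, j]) ` (UNIV :: ('n \<times> 'n) set)"
    by (auto simp: words_def length_Suc_conv numeral_2_eq_2)
  have "S_op b p u = S_op b p (\<Sum>w\<in>words 2. csmult (Poly_Mapping.lookup u w) (mon w))"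
    by (simp add: sum_mon[OF finite_words u])
  also have "\<dots> = (\<Sum>w\<in>words 2. csmult (Poly_Mapping.lookup u w) (S_op b p (mon w)))"
    by (simp add: module_hom.sum[OF linear_S_op] module_hom.scale[OF linear_S_op])
  finally have "S_op b p u - u = (\<Sum>w\<in>words 2.
      csmult (Poly_Mapping.lookup u w) (S_op b p (mon w) - mon w))"
    using sum_mon[OF finite_words u] by (simp add: tensor.scale_right_diff_distrib sum_subtractf)
  also have "\<dots> = (\<Sum>i\<in>UNIV. \<Sum>j\<in>UNIV. h i j)"
    unfolding words2 sum.cartesian_product
    by (subst sum.reindex) (auto simp: inj_on_def h_def split_beta)
  finally have diff: "S_op b p u - u = (\<Sum>i\<in>UNIV. \<Sum>j\<in>UNIV. h i j)" .
  \<comment> \<open>Exchanging the summation variables turns the antisymmetric double sum into its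
    own negative, so it vanishes over the complex numbers.\<close>
  have "(\<Sum>i\<in>UNIV. \<Sum>j\<in>UNIV. h i j) = (\<Sum>i\<in>UNIV. \<Sum>j\<in>UNIV. - h j i)"
    by (intro sum.cong refl antisym')
  also have "\<dots> = - (\<Sum>i\<in>UNIV. \<Sum>j\<in>UNIV. h i j)"
    by (subst sum.swap) (simp add: sum_negf)
  finally have "S_op b p u - u = - (S_op b p u - u)"
    by (simp only: diff)
  then have "Poly_Mapping.lookup (S_op b p u - u) w = - Poly_Mapping.lookup (S_op b p u - u) w" for w
    by (metis lookup_uminus)
  moreover have "c = - c \<Longrightarrow> c = 0" for c :: complex
    by (simp add: complex_eq_iff)
  ultimately have "Poly_Mapping.lookup (S_op b p u - u) w = 0" for w
    by blast
  then show ?thesis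
    by (intro poly_mapping_eqI) (simp add: lookup_minus)
qed

lemma linear_sigma_op: "linear_op (sigma_op b p i)"
  unfolding sigma_op_def by (rule linear_amplify)

lemma sigma_op_invariants:
  assumes "1 \<le> i" "i < n" "u \<in> invariants n"
  shows "sigma_op b p i u = u"
proof -
  have "n = (i - 1) + 2 + (n - i - 1)"
    using assms by simp
  then show ?thesis
    unfolding sigma_op_def using assms(3)
    by (metis amplify_invariants linear_S_op S_op_invariants)
qed

lemma word_op_Nil: "word_op b p [] u = u"
  and word_op_Cons: "word_op b p (i # is) u = sigma_op b p i (word_op b p is u)"
  by (simp_all add: word_op_def)

lemma linear_word_op: "linear_op (word_op b p is)"
proof (induction "is")
  case Nil
  then show ?case
    by (simp add: word_op_def module_hom_iff tensor.module_axioms)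
next
  case (Cons i "is")
  then show ?case
    using linear_sigma_op[of i] by (simp add: word_op_Cons module_hom_iff)
qed

lemma word_op_invariants: "set is \<subseteq> {1..<n} \<Longrightarrow> u \<in> invariants n \<Longrightarrow> word_op b p is u = u"
  by (induction "is") (auto simp: word_op_Nil word_op_Cons intro: sigma_op_invariants)

lemma linear_P_op: "linear_op (P_op b p e n)"
  using linear_word_op
  by (simp add: P_op_def module_hom_iff tensor.module_axioms sum.distrib tensor.scale_right_distrib
      tensor.scale_left_commute flip: tensor.scale_sum_right)

lemma P_op_invariants:
  assumes "expression_choice n e" "u \<in> invariants n"
  shows "P_op b p e n u = u"
proof -
  have "(\<Sum>\<pi> | \<pi> permutes {1..n}. word_op b p (e \<pi>) u) = (\<Sum>\<pi> | \<pi> permutes {1..n}. u)"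
    using assms by (intro sum.cong refl word_op_invariants) (auto simp: expression_choice_def)
  also have "\<dots> = csmult (fact n) u"
    using card_permutations[of "{1..n}" n]
    by (simp add: tensor.sum_constant_scale del: sum_constant)
  finally show ?thesis
    by (simp add: P_op_def)
qed

lemma P_op_funpow_invariants:
  "expression_choice n e \<Longrightarrow> u \<in> invariants n \<Longrightarrow> (P_op b p e n ^^ M) u = u"
  by (induction M) (simp_all add: P_op_invariants)


section \<open>Leading terms and the limit\<close>

text \<open>The product of \<open>b i j\<close> over all inversions, that is, pairs of positions
  with a larger letter \<open>i\<close> before a smaller letter \<open>j\<close>.\<close>

fun inversion_factor :: "'n list \<Rightarrow> complex" where
  "inversion_factor [] = 1"
| "inversion_factor (i # w) = (\<Prod>j\<leftarrow>w. if j < i then b i j else 1) * inversion_factor w"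

lemma inversion_factor_nonzero: "inversion_factor w \<noteq> 0"
  by (induction w) (auto simp: prod_list_zero_iff b_nonzero)

text \<open>Only the swapped pair changes its relative order; all other pairs contribute the same
  factors.\<close>

lemma inversion_factor_swap:
  "j < i \<Longrightarrow> inversion_factor (x @ [i, j] @ y) = b i j * inversion_factor (x @ [j, i] @ y)"
  by (induction x) auto

text \<open>On these rescaled monomials, \<open>\<sigma>\<^sub>i\<close> is a plain transposition of letters up to lower terms.\<close>

definition scaled_mon :: "'n list \<Rightarrow> 'n tensor" where
  "scaled_mon w = csmult (1 / inversion_factor w) (mon w)"

lemma mon_conv_scaled_mon: "mon w = csmult (inversion_factor w) (scaled_mon w)"
  by (simp add: scaled_mon_def inversion_factor_nonzero)

lemma sandwich_p_lower:
  assumes "j < i"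
  shows "mon x * p i j * mon y \<in> lower_tensors (length (x @ [i, j] @ y)) (weight (x @ [i, j] @ y))"
  unfolding lower_tensors_def
  by (rule supported_mono[OF sandwich_supported[OF p_supported[OF assms]]])
    (use weight_pair_less[of _ i _ j] in fastforce)

text \<open>The factor produced by \<open>S_op\<close> is the ratio of the two inversion factors, so
  the leading coefficient becomes 1. What remains is zero for equal letters and otherwise a multiple
  of \<open>p\<close> between the outer words.\<close>

lemma sigma_op_scaled_mon:
  assumes "1 \<le> i" "i < length w"
  shows "sigma_op b p i (scaled_mon w)
    - scaled_mon (permute_word (Transposition.transpose i (i + 1)) w) \<in> lower_tensors (length w) (weight w)"
proof -
  obtain x a c y where w: "w = x @ [a, c] @ y" and x: "length x = i - 1"
    using split_at_position[OF assms] .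
  have sigma: "sigma_op b p i (scaled_mon w)
      = csmult (1 / inversion_factor w) (mon x * S_op b p (mon [a, c]) * mon y)"
    unfolding w scaled_mon_def sigma_op_def
    by (simp only: module_hom.scale[OF linear_amplify]) (subst amplify_mon, use x in simp_all)
  have perm: "permute_word (Transposition.transpose i (i + 1)) w = x @ [c, a] @ y"
    unfolding w by (rule permute_word_transpose[OF assms(1) x])
  have mm: "mon x * (mon [s, t] * mon y) = mon (x @ [s, t] @ y)" for s t
    by (simp add: mon_mult)
  show ?thesis
  proof (cases a c rule: linorder_cases)
    case less
    have "sigma_op b p i (scaled_mon w) - scaled_mon (x @ [c, a] @ y)
        = csmult (- (1 / inversion_factor w * inverse (b c a))) (mon x * p c a * mon y)"
      unfolding sigma S_op_lt[OF less] unfolding w scaled_mon_def inversion_factor_swap[OF less]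
      by (simp add: right_diff_distrib left_diff_distrib csmult_mult_left csmult_mult_right
          mult.assoc mm[simplified] tensor.scale_right_diff_distrib field_simps)
    \<comment> \<open>The bound is available for the letters in the order \<open>c\<close>,
      \<open>a\<close>; the weight ignores the order.\<close>
    moreover have "mon x * p c a * mon y \<in> lower_tensors (length w) (weight w)"
      using sandwich_p_lower[OF less, of x y] unfolding w by (simp add: add.left_commute)
    ultimately show ?thesis
      unfolding perm by (simp only: lower_tensors_def supported_scale)
  next
    case equal
    then show ?thesis
      unfolding perm sigma by (simp add: S_op_eq mult.assoc mm[simplified] w scaled_mon_def
          lower_tensors_def supported_zero)
  next
    case greater
    have "sigma_op b p i (scaled_mon w) - scaled_mon (x @ [c, a] @ y)
        = csmult (1 / inversion_factor w) (mon x * p a c * mon y)"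
      unfolding sigma S_op_gt[OF greater] unfolding w scaled_mon_def inversion_factor_swap[OF greater]
      by (simp add: distrib_left distrib_right csmult_mult_left csmult_mult_right
          mult.assoc mm[simplified] tensor.scale_right_distrib b_nonzero[OF greater])
    moreover have "mon x * p a c * mon y \<in> lower_tensors (length w) (weight w)"
      using sandwich_p_lower[OF greater, of x y] unfolding w .
    ultimately show ?thesis
      unfolding perm by (simp only: lower_tensors_def supported_scale)
  qed
qed

lemma weight_permute_transpose:
  assumes "1 \<le> i" "i < length w"
  shows "weight (permute_word (Transposition.transpose i (i + 1)) w) = weight w"
proof -
  obtain x a c y where w: "w = x @ [a, c] @ y" and x: "length x = i - 1"
    using split_at_position[OF assms] .
  show ?thesis
    unfolding w permute_word_transpose[OF assms(1) x] by (simp add: add.left_commute)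
qed

text \<open>Ensures that errors made by earlier factors stay lower under later ones: each monomial
  goes to a multiple of one of equal weight plus lower terms.\<close>

lemma sigma_op_lower:
  assumes "1 \<le> i" "i < n" "u \<in> lower_tensors n d"
  shows "sigma_op b p i u \<in> lower_tensors n d"
  using linear_sigma_op assms(3) unfolding lower_tensors_def
proof (rule linear_op_supported)
  fix w assume "w \<in> {w :: 'n list. length w = n \<and> weight w < d}"
  then have w: "length w = n" "weight w < d" by auto
  let ?w = "permute_word (Transposition.transpose i (i + 1)) w"
  have i: "i < length w" using w assms by simp
  have "scaled_mon ?w \<in> lower_tensors n d"
    using w weight_permute_transpose[OF assms(1) i]
    by (simp add: scaled_mon_def lower_tensors_def supported_scale)
  moreover have "sigma_op b p i (scaled_mon w) - scaled_mon ?w \<in> lower_tensors n d"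
    using lower_tensors_mono[OF _ sigma_op_scaled_mon[OF assms(1) i]] w by simp
  ultimately have "sigma_op b p i (scaled_mon w) \<in> lower_tensors n d"
    unfolding lower_tensors_def by (metis diff_add_cancel supported_add)
  then show "sigma_op b p i (mon w) \<in> supported {w. length w = n \<and> weight w < d}"
    unfolding mon_conv_scaled_mon module_hom.scale[OF linear_sigma_op] lower_tensors_def
    by (rule supported_scale)
qed

text \<open>Induction along the expression, accumulating lower errors. The permutation and weight
  claims are carried along because the next \<open>\<sigma>\<^sub>i\<close> acts on the permuted
  word.\<close>

lemma word_op_scaled_mon:
  assumes "set is \<subseteq> {1..<length w}"
  defines "\<pi> \<equiv> foldr (\<lambda>j f. Transposition.transpose j (j + 1) \<circ> f) is id"
  shows "\<pi> permutes {1..length w} \<and> weight (permute_word (inv \<pi>) w) = weight w \<and>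
    word_op b p is (scaled_mon w) - scaled_mon (permute_word (inv \<pi>) w)
      \<in> lower_tensors (length w) (weight w)"
  using assms(1) unfolding \<pi>_def
proof (induction "is")
  case Nil
  show ?case
    using permutes_id[of "{1..length w}"]
    by (simp add: word_op_Nil permute_word_id[unfolded id_def] lower_tensors_def supported_zero id_def)
next
  case (Cons i "is")
  let ?t = "Transposition.transpose i (i + 1)"
  define \<tau> where "\<tau> = foldr (\<lambda>j f. Transposition.transpose j (j + 1) \<circ> f) is id"
  define v where "v = permute_word (inv \<tau>) w"
  have i: "1 \<le> i" "i < length w" and "set is \<subseteq> {1..<length w}"
    using Cons.prems by auto
  from Cons.IH[OF this(3)] have IH: "\<tau> permutes {1..length w}" "weight v = weight w"
    "word_op b p is (scaled_mon w) - scaled_mon v \<in> lower_tensors (length w) (weight w)"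
    unfolding \<tau>_def v_def by blast+
  have t: "?t permutes {1..length w}"
    using i by (rule permutes_adjacent)
  have len: "length v = length w"
    by (simp add: v_def)
  have inv: "inv (?t \<circ> \<tau>) = inv \<tau> \<circ> ?t"
    using o_inv_distrib[OF permutes_bij[OF t] permutes_bij[OF IH(1)]] by simp
  have perm: "permute_word (inv (?t \<circ> \<tau>)) w = permute_word ?t v"
    unfolding v_def inv by (rule permute_word_comp[OF t, symmetric])
  \<comment> \<open>The old error is pushed through \<open>\<sigma>\<^sub>i\<close>, and a new one
    arises at \<open>v\<close>.\<close>
  have "sigma_op b p i (word_op b p is (scaled_mon w)) - scaled_mon (permute_word ?t v)
      = sigma_op b p i (word_op b p is (scaled_mon w) - scaled_mon v)
        + (sigma_op b p i (scaled_mon v) - scaled_mon (permute_word ?t v))"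
    by (simp add: module_hom.diff[OF linear_sigma_op])
  also have "\<dots> \<in> lower_tensors (length w) (weight w)"
    using sigma_op_lower[OF i IH(3)] sigma_op_scaled_mon[of i v] i len IH(2)
    unfolding lower_tensors_def by (intro supported_add) auto
  finally have diff: "sigma_op b p i (word_op b p is (scaled_mon w)) - scaled_mon (permute_word ?t v)
      \<in> lower_tensors (length w) (weight w)" .
  have fold: "foldr (\<lambda>j f. Transposition.transpose j (j + 1) \<circ> f) (i # is) id = ?t \<circ> \<tau>"
    by (simp only: \<tau>_def foldr_Cons comp_apply)
  have "weight (permute_word ?t v) = weight w"
    using weight_permute_transpose[of i v] i len IH(2) by simp
  then show ?case
    unfolding fold word_op_Cons perm using permutes_compose[OF IH(1) t] diff by blast
qed

text \<open>The coefficient at a word is the number of permutations carrying \<open>w\<close> to it,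
  divided by its inversion factor. Composing with an adjacent transposition shows that swapping two
  letters keeps the count, so only the ratio \<open>b i j\<close> of inversion factors is
  left.\<close>

lemma average_invariants:
  fixes w :: "'n list"
  defines "n \<equiv> length w"
  shows "(\<Sum>\<rho> | \<rho> permutes {1..n}. scaled_mon (permute_word \<rho> w)) \<in> invariants n" (is "?v \<in> _")
proof -
  define N where "N w' = (\<Sum>\<rho> | \<rho> permutes {1..n}. of_bool (permute_word \<rho> w = w') :: complex)" for w'
  have lookup_v: "Poly_Mapping.lookup ?v w' = N w' / inversion_factor w'" for w'
    unfolding N_def lookup_sum sum_divide_distrib
    by (intro sum.cong) (auto simp: scaled_mon_def lookup_csmult lookup_mon)
  have N_swap: "N (x @ [j, i] @ y) = N (x @ [i, j] @ y)" for x i j y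
  proof (cases "length (x @ [i, j] @ y) = n")
    case True
    define m where "m = length x + 1"
    let ?t = "Transposition.transpose m (m + 1)"
    have t: "?t permutes {1..n}"
      using True by (intro permutes_adjacent) (auto simp: m_def)
    have involution: "permute_word ?t (permute_word ?t v) = v" if "length v = n" for v :: "'n list"
      using permute_word_comp[of ?t v ?t] that t by (simp only: transpose_comp_involutory permute_word_id)
    have "permute_word ?t (x @ [i, j] @ y) = x @ [j, i] @ y"
      by (rule permute_word_transpose) (simp_all add: m_def)
    then have "permute_word (\<rho> \<circ> ?t) w = x @ [j, i] @ y \<longleftrightarrow> permute_word \<rho> w = x @ [i, j] @ y" for \<rho>
      using involution[of "permute_word \<rho> w"] involution[of "x @ [i, j] @ y"] True
        permute_word_comp[of ?t w \<rho>] t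
      by (auto simp: n_def)
    then show ?thesis
      unfolding N_def by (subst sum_permutations_compose_right[OF t]) simp
  next
    case False
    moreover have "N v = 0" if "length v \<noteq> n" for v
      unfolding N_def using that by (intro sum.neutral) (auto simp: n_def)
    ultimately show ?thesis
      by simp
  qed
  have "?v \<in> supported (words n)"
    by (intro supported_sum) (auto simp: scaled_mon_def words_def n_def intro!: supported_scale)
  moreover have "Poly_Mapping.lookup ?v (x @ [j, i] @ y) = b i j * Poly_Mapping.lookup ?v (x @ [i, j] @ y)"
    if "j < i" for x y i j
    unfolding lookup_v inversion_factor_swap[OF that] N_swap[of x i j y]
    using b_nonzero[OF that] by simp
  ultimately show ?thesis
    unfolding invariants_def tensor_power_eq by blast
qed

text \<open>The leading terms of all the chosen expressions together run over all rearrangements of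
  \<open>w\<close>, so their average is invariant.\<close>

lemma P_op_scaled_mon:
  fixes w :: "'n list"
  defines "n \<equiv> length w"
  assumes "expression_choice n e"
  obtains v where "v \<in> invariants n" "P_op b p e n (scaled_mon w) - v \<in> lower_tensors n (weight w)"
proof
  let ?v = "\<Sum>\<rho> | \<rho> permutes {1..n}. scaled_mon (permute_word \<rho> w)"
  show "csmult (1 / fact n) ?v \<in> invariants n"
    unfolding n_def by (intro tensor.subspace_scale[OF subspace_invariants] average_invariants)
  have lower: "word_op b p (e \<pi>) (scaled_mon w) - scaled_mon (permute_word (inv \<pi>) w)
      \<in> lower_tensors n (weight w)" if "\<pi> permutes {1..n}" for \<pi>
  proof -
    have "set (e \<pi>) \<subseteq> {1..<n}"
      and \<pi>: "\<pi> = foldr (\<lambda>j f. Transposition.transpose j (j + 1) \<circ> f) (e \<pi>) id"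
      using assms(2) that unfolding expression_choice_def by blast+
    then show ?thesis
      using word_op_scaled_mon[of "e \<pi>" w, folded n_def, folded \<pi>] by blast
  qed
  \<comment> \<open>Inversion permutes the symmetric group, which matches the average with the
    leading terms.\<close>
  have v: "?v = (\<Sum>\<pi> | \<pi> permutes {1..n}. scaled_mon (permute_word (inv \<pi>) w))"
    by (rule sum_permutations_inverse)
  have "P_op b p e n (scaled_mon w) - csmult (1 / fact n) ?v = csmult (1 / fact n)
      (\<Sum>\<pi> | \<pi> permutes {1..n}. word_op b p (e \<pi>) (scaled_mon w) - scaled_mon (permute_word (inv \<pi>) w))"
    unfolding v P_op_def by (simp add: sum_subtractf tensor.scale_right_diff_distrib)
  also have "\<dots> \<in> lower_tensors n (weight w)"
    using lower unfolding lower_tensors_def by (intro supported_scale supported_sum) simp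
  finally show "P_op b p e n (scaled_mon w) - csmult (1 / fact n) ?v \<in> lower_tensors n (weight w)" .
qed

text \<open>Stationarity is bundled with invariance of the limit. A relation is used so that
  existence can be proved before \<open>THE\<close> in \<open>qsym\<close> is evaluated.\<close>

definition limits_to :: "((nat \<Rightarrow> nat) \<Rightarrow> nat list) \<Rightarrow> nat \<Rightarrow> 'n tensor \<Rightarrow> 'n tensor \<Rightarrow> bool" where
  "limits_to e n u v \<longleftrightarrow> v \<in> invariants n \<and> (\<forall>\<^sub>F M in sequentially. (P_op b p e n ^^ M) u = v)"

text \<open>Finitely many stationary sequences become stationary from a common index on.\<close>

lemma limits_to_sum:
  assumes "finite K" "\<And>w. w \<in> K \<Longrightarrow> \<exists>v. limits_to e n (f w) v"
  shows "\<exists>v. limits_to e n (\<Sum>w\<in>K. csmult (c w) (f w)) v"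
proof -
  obtain g where g: "limits_to e n (f w) (g w)" if "w \<in> K" for w
    using assms(2) by metis
  have lin: "linear_op (P_op b p e n ^^ M)" for M
    by (intro linear_op_funpow linear_P_op)
  have "(\<Sum>w\<in>K. csmult (c w) (g w)) \<in> invariants n"
    using g unfolding limits_to_def
    by (intro tensor.subspace_sum tensor.subspace_scale subspace_invariants) auto
  moreover have "\<forall>\<^sub>F M in sequentially. \<forall>w\<in>K. (P_op b p e n ^^ M) (f w) = g w"
    using assms(1) g unfolding limits_to_def by (intro eventually_ball_finite) auto
  then have "\<forall>\<^sub>F M in sequentially. (P_op b p e n ^^ M) (\<Sum>w\<in>K. csmult (c w) (f w))
      = (\<Sum>w\<in>K. csmult (c w) (g w))"
    by eventually_elim (simp add: module_hom.sum[OF lin] module_hom.scale[OF lin])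
  ultimately show ?thesis
    unfolding limits_to_def by blast
qed

text \<open>One application of \<open>P_op\<close> gives an invariant \<open>v'\<close>, which stays
  fixed, plus a remainder \<open>l\<close> of smaller weight, to which the induction hypothesis
  applies.\<close>

lemma limits_to_mon:
  fixes w :: "'n list"
  assumes "expression_choice n e" "length w = n"
  shows "\<exists>v. limits_to e n (mon w) v"
  using assms(2)
proof (induction "weight w" arbitrary: w rule: less_induct)
  case less
  obtain v where v: "v \<in> invariants n" "P_op b p e n (scaled_mon w) - v \<in> lower_tensors n (weight w)"
    using P_op_scaled_mon[of w e] assms(1) less.prems by auto
  define v' where "v' = csmult (inversion_factor w) v"
  define l where "l = P_op b p e n (mon w) - v'"
  have v': "v' \<in> invariants n"
    unfolding v'_def using v(1) by (rule tensor.subspace_scale[OF subspace_invariants])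
  have "l = csmult (inversion_factor w) (P_op b p e n (scaled_mon w) - v)"
    by (simp add: l_def v'_def tensor.scale_right_diff_distrib mon_conv_scaled_mon[of w]
        module_hom.scale[OF linear_P_op])
  then have l: "l \<in> lower_tensors n (weight w)"
    using v(2) unfolding lower_tensors_def by (simp add: supported_scale)
  then have keys: "x \<in> Poly_Mapping.keys l \<Longrightarrow> length x = n \<and> weight x < weight w" for x
    by (auto simp: lower_tensors_def supported_def)
  have "\<exists>z. limits_to e n (\<Sum>x\<in>Poly_Mapping.keys l. csmult (Poly_Mapping.lookup l x) (mon x)) z"
    using less.hyps keys by (intro limits_to_sum) auto
  then obtain z where z: "limits_to e n l z"
    using sum_mon[of "Poly_Mapping.keys l" l] by (auto simp: supported_def)
  have step: "(P_op b p e n ^^ Suc M) (mon w) = v' + (P_op b p e n ^^ M) l" for M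
  proof -
    have "(P_op b p e n ^^ Suc M) (mon w) = (P_op b p e n ^^ M) (v' + l)"
      by (simp add: funpow_swap1 l_def)
    then show ?thesis
      by (simp add: module_hom.add[OF linear_op_funpow[OF linear_P_op]]
          P_op_funpow_invariants[OF assms(1) v'])
  qed
  have "\<forall>\<^sub>F M in sequentially. (P_op b p e n ^^ Suc M) (mon w) = v' + z"
    using z unfolding limits_to_def step by (auto elim: eventually_mono)
  then have "\<forall>\<^sub>F M in sequentially. (P_op b p e n ^^ M) (mon w) = v' + z"
    \<comment> \<open>Shifting the exponent by one does not affect eventual behaviour.\<close>
    by (simp only: eventually_sequentially_Suc[of "\<lambda>M. (P_op b p e n ^^ M) (mon w) = v' + z"])
  moreover have "v' + z \<in> invariants n"
    using v' z unfolding limits_to_def by (intro tensor.subspace_add[OF subspace_invariants]) auto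
  ultimately show ?case
    unfolding limits_to_def by blast
qed

lemma limits_to_qsym:
  assumes "expression_choice n e" "u \<in> tensor_power n"
  shows "limits_to e n u (qsym b p e n u)"
proof -
  have "\<exists>v. limits_to e n (\<Sum>w\<in>words n. csmult (Poly_Mapping.lookup u w) (mon w)) v"
    by (rule limits_to_sum[OF finite_words]) (simp add: words_def limits_to_mon[OF assms(1)])
  then obtain v where v: "limits_to e n u v"
    using sum_mon[OF finite_words, of u n] assms(2) by (auto simp: tensor_power_eq)
  have "qsym b p e n u = v"
    unfolding qsym_def
  proof (rule the_equality)
    show "\<forall>\<^sub>F M in sequentially. (P_op b p e n ^^ M) u = v"
      using v by (simp add: limits_to_def)
    fix v' assume "\<forall>\<^sub>F M in sequentially. (P_op b p e n ^^ M) u = v'"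
    moreover have "\<forall>\<^sub>F M in sequentially. (P_op b p e n ^^ M) u = v"
      using v by (simp add: limits_to_def)
    ultimately have "\<forall>\<^sub>F M in sequentially. v' = v"
      by eventually_elim simp
    then show "v' = v"
      by simp
  qed
  with v show ?thesis by simp
qed

text \<open>There are finitely many words of length \<open>k\<close>, so on their monomials
  \<open>qsym\<close> agrees with a single power of \<open>P_op\<close>, which is linear and fixes
  invariants.\<close>

lemma amplify_qsym_invariants:
  assumes "expression_choice k e" "u \<in> invariants (r + k + s)"
  shows "amplify r k (qsym b p e k) u = u"
proof -
  have "\<forall>\<^sub>F M in sequentially. \<forall>y\<in>words k. (P_op b p e k ^^ M) (mon y) = qsym b p e k (mon y)"
  proof (intro eventually_ball_finite finite_words ballI)
    fix y :: "'n list" assume "y \<in> words k"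
    then have "limits_to e k (mon y) (qsym b p e k (mon y))"
      by (intro limits_to_qsym assms(1)) (simp add: tensor_power_eq)
    then show "\<forall>\<^sub>F M in sequentially. (P_op b p e k ^^ M) (mon y) = qsym b p e k (mon y)"
      by (simp only: limits_to_def)
  qed
  from eventually_happens'[OF sequentially_bot this]
  obtain M where "\<forall>y\<in>words k. (P_op b p e k ^^ M) (mon y) = qsym b p e k (mon y)" ..
  then have "amplify r k (qsym b p e k) u = amplify r k (P_op b p e k ^^ M) u"
    using assms(2) by (intro amplify_cong) (auto simp: words_def invariants_def)
  also have "\<dots> = u"
    using assms by (intro amplify_invariants linear_op_funpow linear_P_op P_op_funpow_invariants) auto
  finally show ?thesis .
qed

end

theorem proposition5p18:
  fixes q :: complex
    and \<alpha> b :: "'n::{finite, linorder} \<Rightarrow> 'n \<Rightarrow> complex"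
    and p :: "'n \<Rightarrow> 'n \<Rightarrow> 'n tensor"
    and r s k :: nat
    and e e' :: "(nat \<Rightarrow> nat) \<Rightarrow> nat list"
  assumes "q \<noteq> 0"
    and "\<And>i j. j < i \<Longrightarrow> b i j = q powr \<alpha> i j"
    and "\<And>i j. j < i \<Longrightarrow> p i j \<in> tensor_span {mon [x, y] | x y. x < i \<and> y < i}"
    and "EA b p"
    and "k \<ge> 1"
    and "expression_choice k e"
    and "expression_choice (r + k + s) e'"
  shows "\<forall>u \<in> tensor_power (r + k + s).
    amplify r k (qsym b p e k) (qsym b p e' (r + k + s) u) = qsym b p e' (r + k + s) u"
proof -
  have "p i j \<in> supported {[x, y] | x y. x < i \<and> y < i}" if "j < i" for i j
  proof -
    have "tensor_span {mon [x, y] | x y. x < i \<and> y < i} \<subseteq> supported {[x, y] | x y. x < i \<and> y < i}"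
      by (rule tensor.span_minimal[OF _ subspace_supported]) auto
    then show ?thesis
      using assms(3)[OF that] by blast
  qed
  \<comment> \<open>For nonzero \<open>q\<close>, \<open>powr\<close> is a value of the exponential
    function, hence nonzero.\<close>
  then interpret quantum_relations b p
    using assms(1,2) by unfold_locales (auto simp: powr_def)
  show ?thesis
    using amplify_qsym_invariants[OF assms(6)] limits_to_qsym[OF assms(7)]
    unfolding limits_to_def by blast
qed

end
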